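(* Given a nonempty family $\mathcal{P}$ of non-empty $d$-dimensional 0-1 matrices, there exists an integer $k\in[0, d-1]$ such that $\operatorname{ssat}(n,\mathcal{P},d)=\Theta(n^k)$. In particular, $k$ is the smallest integer in $[0, d-1]$ such that both properties below hold for $(\mathcal{P},k)$: (i) For every integer $d'\in[k+1,d-1]$ and for every $d'$-dimensional face $f$ of a $d$-dimensional $2\times\dots\times 2$ 0-1 matrix, there exists $P\in\mathcal{P}$ that has a $1$-entry $o$ in $f$'s counterpart $f_P$ in $P$ such that $o$ is the only $1$-entry in every cross section of $P$ that is $(k+1)$-orthogonal to $f_P$ and contains $o$. (ii) There exists $P\in\mathcal{P}$ that contains a $1$-entry that is the only $1$-entry in every $(d-1-k)$-dimensional cross section of $P$ that it belongs to.
   Context: A 0-1 matrix is non-empty if it has at least one $1$-entry. A $d$-dimensional 0-1 matrix $A$ contains a $d$-dimensional 0-1 matrix $P$ if $A$ has a submatrix (obtained by restricting each of the $d$ coordinates to a subset of its range) of the same dimensions as $P$, called a copy of $P$, that can be turned into $P$ by changing any number of $1$-entries to $0$-entries. A matrix $A$ is $\mathcal{P}$-semisaturated if changing any $0$-entry of $A$ to a $1$-entry introduces a new copy of some element of $\mathcal{P}$ (i.e. a copy in which the changed entry plays the role of a $1$-entry of that element); $A$ is not required to avoid $\mathcal{P}$. $\operatorname{ssat}(n,\mathcal{P},d)$ is the minimum possible number of $1$-entries in a $\mathcal{P}$-semisaturated $d$-dimensional $n\times\dots\times n$ 0-1 matrix. Write $[d]=\{1,\dots,d\}$. A $k$-dimensional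 cross section $L$ of a $d$-dimensional $n_1\times\dots\times n_d$ matrix is the set of all entries whose coordinates on a set $C_L\subseteq[d]$ of $d-k$ dimensions are fixed (to some given values). A cross section $L$ is a face if for every $i\in C_L$ the fixed value of the $i$-th coordinate is some $b_i\in\{1,n_i\}$. For a face $f$ of a $2\times\dots\times2$ matrix with fixed coordinates $b_i\in\{1,2\}$, $i\in C_f$, its counterpart $f_P$ in an $l_1\times\dots\times l_d$ matrix $P$ is the face of $P$ with $C_{f_P}=C_f$ whose $i$-th coordinate is fixed to $1$ if $b_i=1$ and to $l_i$ if $b_i=2$. Two cross sections $L$ and $K$ are orthogonal if $C_L\not\subseteq C_K$ and $C_K\not\subseteq C_L$. A cross section $g$ is $m$-orthogonal to a cross section $f$ if $g$ and $f$ are orthogonal and $|C_g\setminus C_f|\ge m$. Asymptotics are for $n\to\infty$ with $\mathcal{P}$ and $d$ fixed; for $k=0$, $\Theta(n^0)$ means bounded (the value $0$ being allowed). *)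

theory Defs
  imports Complex_Main "HOL-Library.Cardinality" "HOL-Library.Infinite_Set"
    "HOL-Library.Landau_Symbols"
begin

text \<open>
  The finite type \<open>'d\<close> plays the role of the index set \<open>[d]\<close> of the dimensions, so
  \<open>d = CARD('d) \<ge> 1\<close>; the order of the dimensions is irrelevant throughout. Coordinates are
  1-based. Values of \<^term>\<open>entry\<close> outside the index range are junk and never looked at.
\<close>

record 'd mat01 =
  dims :: "'d \<Rightarrow> nat"
  entry :: "('d \<Rightarrow> nat) \<Rightarrow> bool"

definition positions :: "('d \<Rightarrow> nat) \<Rightarrow> ('d \<Rightarrow> nat) set" where
  "positions l = {x. \<forall>i. x i \<in> {1..l i}}"

definition ones :: "'d mat01 \<Rightarrow> ('d \<Rightarrow> nat) set" where
  "ones A = {x \<in> positions (dims A). entry A x}"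

definition nonempty_mat :: "'d mat01 \<Rightarrow> bool" where
  "nonempty_mat A \<longleftrightarrow> ones A \<noteq> {}"

definition set_one :: "'d mat01 \<Rightarrow> ('d \<Rightarrow> nat) \<Rightarrow> 'd mat01" where
  "set_one A x = A\<lparr>entry := (entry A)(x := True)\<rparr>"

text \<open>
  Restricting coordinate \<open>i\<close> to \<open>S i\<close> renumbers the chosen values increasingly:
  position \<open>y\<close> of the submatrix is the position of the original matrix whose \<open>i\<close>-th coordinate
  is the \<open>y i\<close>-th smallest element of \<open>S i\<close> (\<^term>\<open>enumerate\<close> counts from 0).
\<close>

definition origin :: "('d \<Rightarrow> nat set) \<Rightarrow> ('d \<Rightarrow> nat) \<Rightarrow> ('d \<Rightarrow> nat)" where
  "origin S y = (\<lambda>i. enumerate (S i) (y i - 1))"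

definition submatrix :: "'d mat01 \<Rightarrow> ('d \<Rightarrow> nat set) \<Rightarrow> 'd mat01" where
  "submatrix A S = \<lparr>dims = (\<lambda>i. card (S i)), entry = (\<lambda>y. entry A (origin S y))\<rparr>"

definition is_copy :: "'d mat01 \<Rightarrow> ('d \<Rightarrow> nat set) \<Rightarrow> 'd mat01 \<Rightarrow> bool" where
  "is_copy A S P \<longleftrightarrow>
     (\<forall>i. S i \<subseteq> {1..dims A i}) \<and>
     dims (submatrix A S) = dims P \<and>
     ones P \<subseteq> ones (submatrix A S)"

text \<open>
  The last conjunct makes the copy new: the changed entry \<open>x\<close> plays the role of a 1-entry of \<open>P\<close>.
\<close>

definition semisaturated :: "'d mat01 set \<Rightarrow> 'd mat01 \<Rightarrow> bool" where
  "semisaturated \<P> A \<longleftrightarrow>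
     (\<forall>x \<in> positions (dims A) - ones A.
        \<exists>P\<in>\<P>. \<exists>S. is_copy (set_one A x) S P \<and> x \<in> origin S ` ones P)"

text \<open>
  The minimum is over a nonempty set: the all-ones matrix is vacuously semisaturated.
\<close>

definition ssat :: "nat \<Rightarrow> 'd::finite mat01 set \<Rightarrow> nat" where
  "ssat n \<P> = (LEAST m. \<exists>A. dims A = (\<lambda>_. n) \<and> semisaturated \<P> A \<and> card (ones A) = m)"

text \<open>
  A cross section \<open>L\<close> is the partial assignment of fixed values to coordinates, with
  \<open>C\<^sub>L = dom L\<close>, rather than its set of entries: the latter does not determine \<open>C\<^sub>L\<close> when
  some side length is 1.
\<close>

type_synonym 'd csec = "'d \<Rightarrow> nat option"

definition cross_section :: "('d \<Rightarrow> nat) \<Rightarrow> 'd csec \<Rightarrow> bool" where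
  "cross_section l L \<longleftrightarrow> (\<forall>i b. L i = Some b \<longrightarrow> b \<in> {1..l i})"

definition csec_dim :: "'d::finite csec \<Rightarrow> nat" where
  "csec_dim L = CARD('d) - card (dom L)"

definition csec_entries :: "('d \<Rightarrow> nat) \<Rightarrow> 'd csec \<Rightarrow> ('d \<Rightarrow> nat) set" where
  "csec_entries l L = {x \<in> positions l. \<forall>i\<in>dom L. L i = Some (x i)}"

definition face :: "('d \<Rightarrow> nat) \<Rightarrow> 'd csec \<Rightarrow> bool" where
  "face l L \<longleftrightarrow> cross_section l L \<and> (\<forall>i b. L i = Some b \<longrightarrow> b \<in> {1, l i})"

definition counterpart :: "('d \<Rightarrow> nat) \<Rightarrow> 'd csec \<Rightarrow> 'd csec" where
  "counterpart l f = (\<lambda>i. map_option (\<lambda>b. if b = 1 then 1 else l i) (f i))"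

definition orthogonal :: "'d csec \<Rightarrow> 'd csec \<Rightarrow> bool" where
  "orthogonal L K \<longleftrightarrow> \<not> dom L \<subseteq> dom K \<and> \<not> dom K \<subseteq> dom L"

definition m_orthogonal :: "nat \<Rightarrow> 'd csec \<Rightarrow> 'd csec \<Rightarrow> bool" where
  "m_orthogonal m g f \<longleftrightarrow> orthogonal g f \<and> card (dom g - dom f) \<ge> m"

definition only_one_in :: "'d mat01 \<Rightarrow> ('d \<Rightarrow> nat) \<Rightarrow> 'd csec \<Rightarrow> bool" where
  "only_one_in P e L \<longleftrightarrow> ones P \<inter> csec_entries (dims P) L = {e}"

definition property_i :: "'d::finite mat01 set \<Rightarrow> nat \<Rightarrow> bool" where
  "property_i \<P> k \<longleftrightarrow>
     (\<forall>d' \<in> {k + 1..CARD('d) - 1}. \<forall>f. face (\<lambda>_. 2) f \<and> csec_dim f = d' \<longrightarrow>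
        (\<exists>P\<in>\<P>. \<exists>e \<in> ones P \<inter> csec_entries (dims P) (counterpart (dims P) f).
           \<forall>g. cross_section (dims P) g \<and> m_orthogonal (k + 1) g (counterpart (dims P) f) \<and>
               e \<in> csec_entries (dims P) g \<longrightarrow> only_one_in P e g))"

definition property_ii :: "'d::finite mat01 set \<Rightarrow> nat \<Rightarrow> bool" where
  "property_ii \<P> k \<longleftrightarrow>
     (\<exists>P\<in>\<P>. \<exists>e \<in> ones P.
        \<forall>g. cross_section (dims P) g \<and> csec_dim g = CARD('d) - 1 - k \<and>
            e \<in> csec_entries (dims P) g \<longrightarrow> only_one_in P e g)"

text \<open>
  \<open>\<Theta>(n\<^sup>k)\<close> for \<open>n \<rightarrow> \<infinity>\<close>, where \<open>\<Theta>(n\<^sup>0)\<close> is by convention mere boundedness (the value 0 is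
  allowed), unlike the library's \<open>\<Theta>(1)\<close>.
\<close>

definition theta_power :: "(nat \<Rightarrow> nat) \<Rightarrow> nat \<Rightarrow> bool" where
  "theta_power h k \<longleftrightarrow>
     (if k = 0 then (\<lambda>n. real (h n)) \<in> O(\<lambda>_. 1)
      else (\<lambda>n. real (h n)) \<in> \<Theta>(\<lambda>n. real n ^ k))"

end

theory Submission
  imports Defs "HOL-Library.FuncSet"
begin

text \<open>
  If \<open>y\<close> agrees with \<open>e\<close> on a set \<open>C\<close> of coordinates, it also lies in the cross section through
  \<open>e\<close> that fixes only \<open>C - F\<close>. Hence (i) and (ii) together say: for every set \<open>F\<close> of at most
  \<open>d - 1 - k\<close> coordinates and every corner on \<open>F\<close> there are \<open>P \<in> \<P>\<close> and a 1-entry \<open>e\<close> of \<open>P\<close> at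
  that corner such that all other 1-entries of \<open>P\<close> agree with \<open>e\<close> on at most \<open>k\<close> coordinates
  outside \<open>F\<close>; (ii) is the case \<open>F = {}\<close>.

  Upper bound: call a coordinate of a position middle if it is far from both ends, and put 1-entries
  at all positions with at most \<open>k\<close> middle coordinates. Given a 0-entry \<open>x\<close>, let \<open>F\<close> be its set of
  non-middle coordinates, put \<open>e\<close> at \<open>x\<close>, and push the remaining values of each coordinate to the
  two ends; then the middle coordinates of the image of \<open>y\<close> are those outside \<open>F\<close> where \<open>y\<close> agrees
  with \<open>e\<close>.

  Lower bound: if the condition fails for \<open>k - 1\<close> at a corner on \<open>F\<close>, then each position on the
  corresponding face of a semisaturated matrix agrees with some 1-entry on at least \<open>k\<close> coordinates
  outside \<open>F\<close>, and each 1-entry serves only \<open>O(n\<^bsup>d - |F| - k\<^esup>)\<close> positions of the face.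
\<close>

text \<open>A pair \<open>F\<close>, \<open>B\<close> encodes a face without reference to side
  lengths, so one pair can be read both in the members of \<open>\<P>\<close> and in the large
  matrix. Only \<open>B \<inter> F\<close> matters, which lets \<open>B\<close> range over all
  sets.\<close>

definition at_corner :: "('d \<Rightarrow> nat) \<Rightarrow> 'd set \<Rightarrow> 'd set \<Rightarrow> ('d \<Rightarrow> nat) \<Rightarrow> bool" where
  "at_corner l F B x \<longleftrightarrow> (\<forall>i\<in>F. x i = (if i \<in> B then 1 else l i))"

definition isolated :: "'d mat01 \<Rightarrow> 'd set \<Rightarrow> nat \<Rightarrow> ('d \<Rightarrow> nat) \<Rightarrow> bool" where
  "isolated P F k e \<longleftrightarrow> (\<forall>y\<in>ones P - {e}. card {i. i \<notin> F \<and> y i = e i} \<le> k)"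

definition corner_property :: "'d::finite mat01 set \<Rightarrow> nat \<Rightarrow> 'd set \<Rightarrow> 'd set \<Rightarrow> bool" where
  "corner_property \<P> k F B \<longleftrightarrow>
     (\<exists>P\<in>\<P>. \<exists>e\<in>ones P. at_corner (dims P) F B e \<and> isolated P F k e)"

lemma ones_bounds: "x \<in> ones P \<Longrightarrow> 1 \<le> x i \<and> x i \<le> dims P i"
  by (auto simp: ones_def positions_def)

section \<open>Properties (i) and (ii) as conditions on corners\<close>

definition fix_coords :: "'d set \<Rightarrow> ('d \<Rightarrow> nat) \<Rightarrow> 'd csec" where
  "fix_coords C e = (\<lambda>i. if i \<in> C then Some (e i) else None)"

lemma dom_fix_coords [simp]: "dom (fix_coords C e) = C"
  by (auto simp: fix_coords_def dom_def)

lemma cross_section_fix_coords: "e \<in> ones P \<Longrightarrow> cross_section (dims P) (fix_coords C e)"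
  using ones_bounds[of e P] by (auto simp: cross_section_def fix_coords_def)

lemma mem_csec_fix_coords:
  "y \<in> csec_entries l (fix_coords C e) \<longleftrightarrow> y \<in> positions l \<and> (\<forall>i\<in>C. y i = e i)"
  by (auto simp: csec_entries_def fix_coords_def dom_def split: if_splits)

lemma csec_entries_agree:
  "\<lbrakk>x \<in> csec_entries l g; y \<in> csec_entries l g; i \<in> dom g\<rbrakk> \<Longrightarrow> x i = y i"
  by (force simp: csec_entries_def)

lemma ones_subset_positions: "ones P \<subseteq> positions (dims P)"
  by (auto simp: ones_def)

lemma only_one_in_iff:
  assumes "e \<in> ones P" "e \<in> csec_entries (dims P) g"
  shows "only_one_in P e g \<longleftrightarrow> (\<forall>y\<in>ones P. y \<in> csec_entries (dims P) g \<longrightarrow> y = e)"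
  using assms by (auto simp: only_one_in_def)

lemma isolated_csec:
  fixes P :: "'d::finite mat01"
  assumes "isolated P F k e" "e \<in> ones P" "e \<in> csec_entries (dims P) g" "k < card (dom g - F)"
  shows "only_one_in P e g"
  unfolding only_one_in_iff[OF assms(2,3)]
proof (intro ballI impI)
  fix y assume y: "y \<in> ones P" "y \<in> csec_entries (dims P) g"
  have "dom g - F \<subseteq> {i. i \<notin> F \<and> y i = e i}"
    using csec_entries_agree[OF y(2) assms(3)] by auto
  then have "k < card {i. i \<notin> F \<and> y i = e i}"
    using assms(4) by (meson card_mono finite less_le_trans)
  then show "y = e"
    using assms(1) y(1) by (force simp: isolated_def)
qed

text \<open>A second 1-entry agreeing with \<open>e\<close> on more than \<open>k\<close>
  coordinates outside \<open>F\<close> would share with \<open>e\<close> a cross section that fixes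
  exactly \<open>k + 1\<close> of them.\<close>

lemma isolatedI:
  fixes P :: "'d::finite mat01"
  assumes "e \<in> ones P"
    and "\<And>C. \<lbrakk>C \<inter> F = {}; card C = Suc k\<rbrakk> \<Longrightarrow> only_one_in P e (fix_coords C e)"
  shows "isolated P F k e"
  unfolding isolated_def
proof (intro ballI, rule ccontr)
  fix y assume y: "y \<in> ones P - {e}" and "\<not> card {i. i \<notin> F \<and> y i = e i} \<le> k"
  then obtain C where C: "C \<subseteq> {i. i \<notin> F \<and> y i = e i}" "card C = Suc k"
    by (meson not_less_eq_eq obtain_subset_with_card_n)
  then have "only_one_in P e (fix_coords C e)"
    by (intro assms(2)) auto
  moreover have "y \<in> csec_entries (dims P) (fix_coords C e)"
    using y C ones_subset_positions by (fastforce simp: mem_csec_fix_coords)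
  ultimately show False
    using y by (auto simp: only_one_in_def)
qed

lemma dom_counterpart [simp]: "dom (counterpart l f) = dom f"
  by (auto simp: counterpart_def dom_def)

lemma mem_counterpart_iff:
  "e \<in> csec_entries l (counterpart l f) \<longleftrightarrow>
    e \<in> positions l \<and> at_corner l (dom f) {i. f i = Some 1} e"
proof -
  have "(\<forall>i\<in>dom f. counterpart l f i = Some (e i)) \<longleftrightarrow> at_corner l (dom f) {i. f i = Some 1} e"
    unfolding at_corner_def
  proof (rule ball_cong)
    fix i assume "i \<in> dom f"
    then obtain b where "f i = Some b" by blast
    then show "counterpart l f i = Some (e i) \<longleftrightarrow> e i = (if i \<in> {i. f i = Some 1} then 1 else l i)"
      by (simp add: counterpart_def eq_commute[of "e i"])
  qed simp
  then show ?thesis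
    by (simp add: csec_entries_def)
qed

text \<open>Orthogonality excludes \<open>F = {}\<close>, since the empty set lies inside
  \<open>C\<close>; that case has to come from (ii).\<close>

lemma m_orthogonal_fix_coords:
  assumes "F = dom f" "F \<noteq> {}" "C \<inter> F = {}" "card C = Suc k"
  shows "m_orthogonal (k + 1) (fix_coords C e) (counterpart l f)"
proof -
  have "C - F = C" "C \<noteq> {}" using assms by auto
  moreover have "\<not> C \<subseteq> F" "\<not> F \<subseteq> C" using assms(2,3) \<open>C \<noteq> {}\<close> by blast+
  ultimately show ?thesis
    using assms(1,4) by (simp add: m_orthogonal_def orthogonal_def)
qed

text \<open>A \<open>d'\<close>-dimensional face fixes \<open>CARD('d) - d'\<close> coordinates, so
  \<open>d' \<le> CARD('d) - 1\<close> turns into \<open>F \<noteq> {}\<close>, and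
  \<open>k + 1 \<le> d'\<close> into \<open>card F + k < CARD('d)\<close>.\<close>

lemma property_i_iff:
  fixes \<P> :: "'d::finite mat01 set"
  shows "property_i \<P> k \<longleftrightarrow>
    (\<forall>F B. F \<noteq> {} \<longrightarrow> card F + k < CARD('d) \<longrightarrow> corner_property \<P> k F B)"
proof (intro iffI allI impI)
  fix F B :: "'d set"
  assume i: "property_i \<P> k" and F: "F \<noteq> {}" "card F + k < CARD('d)"
  \<comment> \<open>This is the face of the \<open>2 \<times> \<dots> \<times> 2\<close> matrix
    whose counterpart fixes the coordinates in \<open>F\<close> at the ends prescribed by
    \<open>B\<close>.\<close>
  define f where "f = (\<lambda>i. if i \<in> F then Some (if i \<in> B then 1 else 2::nat) else None)"
  have dom_f: "dom f = F"
    by (auto simp: f_def dom_def)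
  have face: "face (\<lambda>_. 2) f"
    by (auto simp: face_def cross_section_def f_def split: if_splits)
  have cF: "card F > 0"
    using F by (simp add: card_gt_0_iff)
  have "csec_dim f \<in> {k + 1..CARD('d) - 1}"
    using F(2) cF by (auto simp: csec_dim_def dom_f)
  with i face obtain P e where P: "P \<in> \<P>" "e \<in> ones P"
    "e \<in> csec_entries (dims P) (counterpart (dims P) f)"
    and only: "\<And>g. \<lbrakk>cross_section (dims P) g; m_orthogonal (k + 1) g (counterpart (dims P) f);
      e \<in> csec_entries (dims P) g\<rbrakk> \<Longrightarrow> only_one_in P e g"
    unfolding property_i_def by (metis IntE)
  have "isolated P F k e"
  proof (rule isolatedI[OF P(2)])
    fix C assume C: "C \<inter> F = {}" "card C = Suc k"
    show "only_one_in P e (fix_coords C e)"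
      using P ones_subset_positions
      by (intro only cross_section_fix_coords m_orthogonal_fix_coords[OF dom_f[symmetric] F(1) C])
        (auto simp: mem_csec_fix_coords)
  qed
  moreover have "at_corner (dims P) F B e"
    using P(3) unfolding mem_counterpart_iff dom_f
    by (auto simp: at_corner_def f_def)
  ultimately show "corner_property \<P> k F B"
    using P by (auto simp: corner_property_def)
next
  assume Q: "\<forall>F B. F \<noteq> {} \<longrightarrow> card F + k < CARD('d) \<longrightarrow> corner_property \<P> k F B"
  show "property_i \<P> k"
    unfolding property_i_def
  proof (intro ballI allI impI)
    fix d' and f :: "'d csec"
    assume d': "d' \<in> {k + 1..CARD('d) - 1}" and f: "face (\<lambda>_. 2) f \<and> csec_dim f = d'"
    have dom: "card (dom f) + k < CARD('d)" "dom f \<noteq> {}"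
      using d' f by (auto simp: csec_dim_def)
    have "corner_property \<P> k (dom f) {i. f i = Some 1}"
      using Q[rule_format, OF dom(2,1)] .
    then obtain P e where P: "P \<in> \<P>" "e \<in> ones P" "isolated P (dom f) k e"
      "at_corner (dims P) (dom f) {i. f i = Some 1} e"
      unfolding corner_property_def by blast
    have "only_one_in P e g" if "m_orthogonal (k + 1) g (counterpart (dims P) f)"
      "e \<in> csec_entries (dims P) g" for g
      using isolated_csec[OF P(3,2) that(2)] that(1) by (auto simp: m_orthogonal_def)
    then show "\<exists>P\<in>\<P>. \<exists>e\<in>ones P \<inter> csec_entries (dims P) (counterpart (dims P) f).
      \<forall>g. cross_section (dims P) g \<and> m_orthogonal (k + 1) g (counterpart (dims P) f) \<and>
          e \<in> csec_entries (dims P) g \<longrightarrow> only_one_in P e g"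
      using P f mem_counterpart_iff[of e "dims P" f] ones_subset_positions[of P]
      by (intro bexI[of _ P] bexI[of _ e]) auto
  qed
qed

lemma property_ii_iff:
  fixes \<P> :: "'d::finite mat01 set"
  assumes "k < CARD('d)"
  shows "property_ii \<P> k \<longleftrightarrow> (\<forall>B. corner_property \<P> k {} B)"
proof -
  \<comment> \<open>The bound on \<open>k\<close> keeps the natural subtraction from truncating;
    otherwise the right-hand side would be 0 while no cross section can fix \<open>Suc k\<close>
    coordinates.\<close>
  have dim: "csec_dim g = CARD('d) - 1 - k \<longleftrightarrow> card (dom g) = Suc k" for g :: "'d csec"
    using assms card_mono[of UNIV "dom g"] by (auto simp: csec_dim_def)
  have "(\<forall>g. cross_section (dims P) g \<and> csec_dim g = CARD('d) - 1 - k \<and>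
          e \<in> csec_entries (dims P) g \<longrightarrow> only_one_in P e g) \<longleftrightarrow> isolated P {} k e"
    if e: "e \<in> ones P" for P :: "'d mat01" and e
    unfolding dim
  proof
    assume L: "\<forall>g. cross_section (dims P) g \<and> card (dom g) = Suc k \<and>
          e \<in> csec_entries (dims P) g \<longrightarrow> only_one_in P e g"
    show "isolated P {} k e"
      using e ones_subset_positions
      by (intro isolatedI L[rule_format] conjI cross_section_fix_coords)
        (auto simp: mem_csec_fix_coords)
  qed (auto intro: isolated_csec e)
  then show ?thesis
    by (auto simp: property_ii_def corner_property_def at_corner_def)
qed

lemma properties_iff:
  fixes \<P> :: "'d::finite mat01 set"
  assumes "k < CARD('d)"
  shows "property_i \<P> k \<and> property_ii \<P> k \<longleftrightarrow>
    (\<forall>F B. card F + k < CARD('d) \<longrightarrow> corner_property \<P> k F B)"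
  unfolding property_i_iff property_ii_iff[OF assms] using assms by (metis add_0 card.empty)

text \<open>Distinct positions agree on at most \<open>CARD('d) - 1\<close> coordinates, and for
  this \<open>k\<close> only \<open>F = {}\<close> has to be considered, so any 1-entry is a
  witness. This makes the least admissible \<open>k\<close> well defined and bounds it.\<close>

lemma properties_top:
  fixes \<P> :: "'d::finite mat01 set"
  assumes "\<P> \<noteq> {}" "\<forall>P\<in>\<P>. nonempty_mat P"
  shows "property_i \<P> (CARD('d) - 1) \<and> property_ii \<P> (CARD('d) - 1)"
proof -
  obtain P e where P: "P \<in> \<P>" "e \<in> ones P"
    using assms by (fastforce simp: nonempty_mat_def)
  have "isolated P {} (CARD('d) - 1) e"
    unfolding isolated_def
  proof
    fix y assume "y \<in> ones P - {e}"
    then have "{i. i \<notin> {} \<and> y i = e i} \<subset> UNIV" by auto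
    then have "card {i. i \<notin> {} \<and> y i = e i} < CARD('d)"
      by (intro psubset_card_mono) auto
    then show "card {i. i \<notin> {} \<and> y i = e i} \<le> CARD('d) - 1" by simp
  qed
  with P have "corner_property \<P> (CARD('d) - 1) {} B" for B
    by (auto simp: corner_property_def at_corner_def)
  moreover have "F = {}" if "card F + (CARD('d) - 1) < CARD('d)" for F :: "'d set"
  proof -
    have "card F = 0" using that by linarith
    then show ?thesis by simp
  qed
  ultimately show ?thesis
    by (subst properties_iff) auto
qed

section \<open>The minimum, and counting positions\<close>

lemma ssat_attained:
  fixes \<P> :: "'d::finite mat01 set"
  shows "\<exists>A. dims A = (\<lambda>_. n) \<and> semisaturated \<P> A \<and> card (ones A) = ssat n \<P>"
proof -
  define A :: "'d mat01" where "A = \<lparr>dims = (\<lambda>_. n), entry = (\<lambda>_. True)\<rparr>"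
  have "\<exists>m A. dims A = (\<lambda>_. n) \<and> semisaturated \<P> A \<and> card (ones A) = m"
    by (intro exI[of _ "card (ones A)"] exI[of _ A]) (auto simp: A_def semisaturated_def ones_def)
  then show ?thesis
    unfolding ssat_def by (rule LeastI_ex)
qed

lemma ssat_le:
  "dims A = (\<lambda>_. n) \<Longrightarrow> semisaturated \<P> A \<Longrightarrow> ssat n \<P> \<le> card (ones A)"
  unfolding ssat_def by (rule Least_le) blast

lemma card_Compl_finite: "card (- F :: 'd::finite set) = CARD('d) - card F"
  by (simp add: Compl_eq_Diff_UNIV card_Diff_subset)

lemma card_functions:
  fixes T :: "'d::finite \<Rightarrow> nat set"
  shows "card {x. \<forall>i. x i \<in> T i} = (\<Prod>i\<in>UNIV. card (T i))"
proof -
  have "{x. \<forall>i. x i \<in> T i} = PiE UNIV T" by (auto simp: PiE_UNIV_domain)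
  then show ?thesis by (simp add: card_PiE)
qed

lemma finite_functions:
  fixes T :: "'d::finite \<Rightarrow> nat set"
  assumes "\<And>i. finite (T i)"
  shows "finite {x. \<forall>i. x i \<in> T i}"
proof -
  have "{x. \<forall>i. x i \<in> T i} = PiE UNIV T" by (auto simp: PiE_UNIV_domain)
  then show ?thesis using assms by (simp add: finite_PiE)
qed

lemma finite_ones: "finite (ones (A :: 'd::finite mat01))"
proof (rule finite_subset)
  show "ones A \<subseteq> {x. \<forall>i. x i \<in> {1..dims A i}}" by (auto simp: ones_def positions_def)
qed (rule finite_functions, simp)

section \<open>Copies preserve order and corners\<close>

lemma is_copyD:
  assumes "is_copy A S P" "y \<in> ones P"
  shows "finite (S i)" "card (S i) = dims P i" "y i - 1 < card (S i)"
    "origin S y i \<in> S i"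
proof -
  have sub: "S j \<subseteq> {1..dims A j}" for j using assms by (auto simp: is_copy_def)
  then show fin: "finite (S i)" for i by (meson finite_atLeastAtMost finite_subset)
  show card: "card (S i) = dims P i" for i
    using assms(1) unfolding is_copy_def submatrix_def by (metis mat01.select_convs(1))
  show less: "y i - 1 < card (S i)" for i
    using ones_bounds[OF assms(2), of i] card[of i] by linarith
  show "origin S y i \<in> S i" for i
    unfolding origin_def using fin less by (rule finite_enumerate_in_set)
qed

lemma origin_in_ones:
  assumes "is_copy A S P" "y \<in> ones P"
  shows "origin S y \<in> ones A"
proof -
  have "y \<in> ones (submatrix A S)" using assms by (auto simp: is_copy_def)
  then show "origin S y \<in> ones A"
    using is_copyD(4)[OF assms] assms(1) by (fastforce simp: is_copy_def ones_def positions_def submatrix_def)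
qed

lemma origin_less_iff:
  assumes "is_copy A S P" "y \<in> ones P" "z \<in> ones P"
  shows "origin S y i < origin S z i \<longleftrightarrow> y i < z i"
proof -
  have mono: "origin S y i < origin S z i" if "y \<in> ones P" "z \<in> ones P" "y i < z i" for y z
    unfolding origin_def using that ones_bounds[of y P i] is_copyD[OF assms(1), of _ i]
    by (intro finite_enumerate_mono) auto
  have "origin S y i = origin S z i" if "y i = z i"
    using that by (simp add: origin_def)
  then show ?thesis
    using mono assms(2,3) by (metis less_asym' less_irrefl nat_neq_iff)
qed

lemma origin_eq_iff:
  assumes "is_copy A S P" "y \<in> ones P" "z \<in> ones P"
  shows "origin S y i = origin S z i \<longleftrightarrow> y i = z i"
  using origin_less_iff[OF assms] origin_less_iff[OF assms(1,3,2)] by (metis nat_neq_iff)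

text \<open>If \<open>e i\<close> were not the first index where \<open>origin S e\<close> has
  coordinate 1, the copy would select a value below 1; likewise at the far end it would select a
  value beyond \<open>dims A i\<close>.\<close>

lemma copy_at_corner:
  assumes copy: "is_copy A S P" and e: "e \<in> ones P" and corner: "at_corner (dims A) F B (origin S e)"
  shows "at_corner (dims P) F B e"
  unfolding at_corner_def
proof
  fix i assume "i \<in> F"
  then have x: "origin S e i = (if i \<in> B then 1 else dims A i)"
    using corner by (simp add: at_corner_def)
  note copyD = is_copyD[OF copy e, of i]
  have sub: "S i \<subseteq> {1..dims A i}" using copy by (auto simp: is_copy_def)
  have eb: "1 \<le> e i" "e i \<le> dims P i" using ones_bounds[OF e] by auto
  show "e i = (if i \<in> B then 1 else dims P i)"
  proof (cases "i \<in> B")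
    case True
    have "\<not> 0 < e i - 1"
    proof
      assume "0 < e i - 1"
      then have "enumerate (S i) 0 < enumerate (S i) (e i - 1)"
        using copyD by (intro finite_enumerate_mono)
      moreover have "enumerate (S i) 0 \<in> S i"
        using copyD by (intro finite_enumerate_in_set) auto
      ultimately show False using x True sub by (fastforce simp: origin_def)
    qed
    then show ?thesis using True eb by auto
  next
    case False
    have "\<not> e i < card (S i)"
    proof
      assume "e i < card (S i)"
      then have "enumerate (S i) (e i - 1) < enumerate (S i) (e i)" "enumerate (S i) (e i) \<in> S i"
        using copyD eb by (auto intro!: finite_enumerate_mono finite_enumerate_in_set)
      then show False using x False sub by (fastforce simp: origin_def)
    qed
    then show ?thesis using False eb copyD by auto
  qed
qed

section \<open>Lower bound by counting on a face\<close>

lemma ones_set_one: "ones (set_one A x) \<subseteq> insert x (ones A)"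
  by (auto simp: ones_def set_one_def)

lemma dims_set_one [simp]: "dims (set_one A x) = dims A"
  by (simp add: set_one_def)

text \<open>The new copy at a 0-entry \<open>x\<close> of the face has its 1-entry \<open>e\<close>
  at the same corner of \<open>P\<close>. Since \<open>e\<close> cannot be isolated there, some
  other 1-entry of the copy agrees with \<open>x\<close> on many coordinates.\<close>

lemma face_covered:
  fixes A :: "'d::finite mat01"
  assumes semi: "semisaturated \<P> A" and fail: "\<not> corner_property \<P> k F B"
    and F: "card F + Suc k \<le> CARD('d)"
    and x: "x \<in> positions (dims A)" "at_corner (dims A) F B x"
  shows "\<exists>z\<in>ones A. \<exists>C. C \<subseteq> - F \<and> card C = Suc k \<and> (\<forall>i\<in>C. x i = z i)"
proof (cases "x \<in> ones A")
  case True
  \<comment> \<open>A 1-entry covers itself; the bound on \<open>card F\<close> leaves enough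
    coordinates to choose \<open>C\<close> from.\<close>
  have "Suc k \<le> card (- F)" using F by (simp add: card_Compl_finite)
  then obtain C where "C \<subseteq> - F" "card C = Suc k" by (meson obtain_subset_with_card_n)
  then show ?thesis using True by blast
next
  case False
  then obtain P S e where P: "P \<in> \<P>" and copy: "is_copy (set_one A x) S P"
    and e: "e \<in> ones P" and xe: "x = origin S e"
    using semi x(1) unfolding semisaturated_def by blast
  have "at_corner (dims P) F B e"
    using copy_at_corner[OF copy e] x(2) xe by simp
  with fail P e have "\<not> isolated P F k e"
    by (auto simp: corner_property_def)
  then obtain y where y: "y \<in> ones P" "y \<noteq> e" "Suc k \<le> card {i. i \<notin> F \<and> y i = e i}"
    by (auto simp: isolated_def not_le Suc_le_eq)
  then obtain C where C: "C \<subseteq> {i. i \<notin> F \<and> y i = e i}" "card C = Suc k"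
    by (meson obtain_subset_with_card_n)
  \<comment> \<open>Only \<open>x\<close> was changed, so any other 1-entry of the copy was already
    a 1-entry of \<open>A\<close>.\<close>
  have "origin S y \<noteq> x"
    using y(2) origin_eq_iff[OF copy y(1) e] unfolding xe by (metis ext)
  then have "origin S y \<in> ones A"
    using origin_in_ones[OF copy y(1)] ones_set_one by fast
  then show ?thesis
    using C by (intro bexI[of _ "origin S y"] exI[of _ C]) (auto simp: xe origin_def)
qed

text \<open>Equality can fail, because a prescribed value outside the range leaves no position at
  all.\<close>

lemma card_fixed_positions:
  "card {x :: 'd::finite \<Rightarrow> nat. (\<forall>i. x i \<in> {1..n}) \<and> (\<forall>i\<in>F. x i = c i)} \<le> n ^ (CARD('d) - card F)"
  (is "card ?X \<le> _")
proof -
  have sub: "?X \<subseteq> {x. \<forall>i. x i \<in> (if i \<in> F then {c i} else {1..n})}" by auto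
  have "card ?X \<le> (\<Prod>i\<in>UNIV. card (if i \<in> F then {c i} else {1..n}))"
    using card_mono[OF finite_functions sub] by (simp add: card_functions)
  also have "\<dots> = (\<Prod>i\<in>UNIV. if i \<in> F then 1 else n)"
    by (intro prod.cong) auto
  also have "\<dots> = n ^ card (- F)"
    by (subst prod.If_cases) auto
  finally show ?thesis by (simp add: card_Compl_finite)
qed

lemma card_face:
  assumes "1 \<le> n"
  shows "card {x :: 'd::finite \<Rightarrow> nat. x \<in> positions (\<lambda>_. n) \<and> at_corner (\<lambda>_. n) F B x}
    = n ^ (CARD('d) - card F)"
proof -
  have "x i \<in> {1..n} \<and> (i \<in> F \<longrightarrow> x i = (if i \<in> B then 1 else n)) \<longleftrightarrow>
      x i \<in> (if i \<in> F then {if i \<in> B then 1 else n} else {1..n})" for x :: "'d \<Rightarrow> nat" and i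
    using assms by auto
  then have "{x. x \<in> positions (\<lambda>_. n) \<and> at_corner (\<lambda>_. n) F B x} =
    {x. \<forall>i. x i \<in> (if i \<in> F then {if i \<in> B then 1 else n} else {1..n})}"
    unfolding positions_def at_corner_def mem_Collect_eq by blast
  also have "card \<dots> = (\<Prod>i\<in>UNIV. card (if i \<in> F then {if i \<in> B then 1 else n} else {1..n}))"
    by (rule card_functions)
  also have "\<dots> = (\<Prod>i\<in>UNIV. if i \<in> F then 1 else n)"
    by (intro prod.cong) auto
  also have "\<dots> = n ^ card (- F)"
    by (subst prod.If_cases) auto
  finally show ?thesis by (simp add: card_Compl_finite)
qed

text \<open>The face has \<open>n ^ u\<close> positions with \<open>u = CARD('d) - card F\<close>.
  Each pair of a 1-entry \<open>z\<close> and a set \<open>C\<close> covers at most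
  \<open>n ^ (u - Suc k)\<close> of them, and \<open>2 ^ CARD('d)\<close> bounds the choices of
  \<open>C\<close>.\<close>

lemma ssat_lower:
  fixes \<P> :: "'d::finite mat01 set"
  assumes fail: "\<not> corner_property \<P> k F B" and F: "card F + Suc k \<le> CARD('d)" and n: "1 \<le> n"
  shows "n ^ Suc k \<le> 2 ^ CARD('d) * ssat n \<P>"
proof -
  obtain A :: "'d mat01" where A: "dims A = (\<lambda>_. n)" "semisaturated \<P> A" "card (ones A) = ssat n \<P>"
    using ssat_attained by blast
  define u where "u = CARD('d) - card F"
  define X where "X = {x. x \<in> positions (\<lambda>_::'d. n) \<and> at_corner (\<lambda>_. n) F B x}"
  define Y where "Y = (\<lambda>(z, C). {x \<in> X. \<forall>i\<in>C. x i = z i})"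
  define I where "I = ones A \<times> {C. C \<subseteq> - F \<and> card C = Suc k}"
  have "X \<subseteq> (\<Union>p\<in>I. Y p)"
    using face_covered[OF A(2) fail F] unfolding X_def Y_def I_def A(1) by fastforce
  have finI: "finite I" by (simp add: I_def finite_ones)
  have finX: "finite X"
    by (rule finite_subset[OF _ finite_functions[of "\<lambda>_. {1..n}"]]) (auto simp: X_def positions_def)
  have Y: "card (Y p) \<le> n ^ (u - Suc k)" if p: "p \<in> I" for p
  proof -
    obtain z C where zC: "p = (z, C)" "C \<subseteq> - F" "card C = Suc k"
      using p by (auto simp: I_def)
    \<comment> \<open>A position covered by the pair has its values on \<open>C\<close> dictated by
      \<open>z\<close> and those on \<open>F\<close> by the corner; the two sets are disjoint, so
      \<open>card F + Suc k\<close> coordinates are determined.\<close>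
    define c where "c i = (if i \<in> C then z i else if i \<in> B then 1 else n)" for i
    have sub: "Y p \<subseteq> {x. (\<forall>i. x i \<in> {1..n}) \<and> (\<forall>i\<in>F \<union> C. x i = c i)}"
      using zC(2) by (auto simp: zC(1) Y_def X_def positions_def at_corner_def c_def)
    have "card (Y p) \<le> card {x. (\<forall>i. x i \<in> {1..n}) \<and> (\<forall>i\<in>F \<union> C. x i = c i)}"
      by (rule card_mono[OF _ sub], rule finite_subset[OF _ finite_functions[of "\<lambda>_. {1..n}"]]) auto
    also have "\<dots> \<le> n ^ (CARD('d) - card (F \<union> C))"
      by (rule card_fixed_positions)
    also have "card (F \<union> C) = card F + Suc k"
      using zC by (subst card_Un_disjoint) auto
    finally show ?thesis by (simp add: u_def)
  qed
  have "n ^ (Suc k + (u - Suc k)) = card X"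
  proof -
    have "Suc k + (u - Suc k) = u" using F by (simp add: u_def)
    then show ?thesis by (simp only: X_def card_face[OF n] u_def)
  qed
  also have "\<dots> \<le> card (\<Union>p\<in>I. Y p)"
    using \<open>X \<subseteq> _\<close> finI finX by (intro card_mono) (auto simp: Y_def)
  also have "\<dots> \<le> (\<Sum>p\<in>I. card (Y p))"
    using finI by (rule card_UN_le)
  also have "\<dots> \<le> card I * n ^ (u - Suc k)"
    using sum_bounded_above[of I "\<lambda>p. card (Y p)"] Y by simp
  finally have "n ^ Suc k \<le> card I"
    using n by (simp add: power_add)
  also have "card I = ssat n \<P> * card {C. C \<subseteq> - F \<and> card C = Suc k}"
    by (simp add: I_def card_cartesian_product A(3))
  also have "card {C. C \<subseteq> - F \<and> card C = Suc k} \<le> card (UNIV :: 'd set set)"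
    by (rule card_mono) auto
  also have "card (UNIV :: 'd set set) = 2 ^ CARD('d)"
    by (simp add: card_UNIV_set)
  finally show ?thesis by (simp add: mult.commute)
qed

section \<open>Upper bound by a matrix with thick borders\<close>

text \<open>Exactly \<open>v - 1\<close> elements of the image lie below \<open>\<phi> v\<close>,
  and \<open>enumerate\<close> counts from 0. Copies can therefore be described by increasing maps
  instead of by sets.\<close>

lemma enumerate_image_strict_mono:
  fixes \<phi> :: "nat \<Rightarrow> nat"
  assumes mono: "strict_mono_on {1..l} \<phi>" and v: "1 \<le> v" "v \<le> l"
  shows "enumerate (\<phi> ` {1..l}) (v - 1) = \<phi> v"
proof -
  let ?S = "\<phi> ` {1..l}"
  have card: "card (\<phi> ` {1..j}) = j" if "j \<le> l" for j
    using strict_mono_on_imp_inj_on[OF mono] that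
    by (subst card_image) (auto intro: inj_on_subset)
  have "{s \<in> ?S. s < \<phi> v} = \<phi> ` {1..v - 1}"
    using v strict_mono_on_less[OF mono, of _ v] by (auto intro!: imageI)
  then have "card {s \<in> ?S. s < \<phi> v} = v - 1"
    using card[of "v - 1"] v by simp
  moreover obtain m where m: "m < card ?S" "enumerate ?S m = \<phi> v"
    using finite_enumerate_Ex[of ?S "\<phi> v"] v by auto
  moreover have "{s \<in> ?S. s < enumerate ?S m} = enumerate ?S ` {..<m}"
  proof (intro equalityI subsetI)
    fix s assume s: "s \<in> {s \<in> ?S. s < enumerate ?S m}"
    then obtain j where j: "j < card ?S" "s = enumerate ?S j"
      using finite_enumerate_Ex[of ?S s] by auto
    then have "j < m"
      using s m(1) by simp
    then show "s \<in> enumerate ?S ` {..<m}"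
      using j(2) by blast
  next
    fix s assume "s \<in> enumerate ?S ` {..<m}"
    then show "s \<in> {s \<in> ?S. s < enumerate ?S m}"
      using m(1) by (auto simp del: imageE intro: finite_enumerate_in_set)
  qed
  moreover have "inj_on (enumerate ?S) {..<m}"
    using bij_betw_imp_inj_on[OF finite_bij_enumerate[of ?S]] m(1) by (auto intro: inj_on_subset)
  ultimately show ?thesis
    by (simp add: card_image)
qed

text \<open>The strips left out at the two ends hold \<open>M\<close> values each, enough room for a
  whole side of a matrix with \<open>dims P i \<le> M\<close>.\<close>

definition middle :: "nat \<Rightarrow> nat \<Rightarrow> ('d \<Rightarrow> nat) \<Rightarrow> 'd set" where
  "middle M n x = {i. M < x i \<and> x i \<le> n - M}"

definition border_mat :: "nat \<Rightarrow> nat \<Rightarrow> nat \<Rightarrow> 'd mat01" where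
  "border_mat M k n = \<lparr>dims = (\<lambda>_. n), entry = (\<lambda>x. card (middle M n x) \<le> k)\<rparr>"

lemma ones_border_mat:
  "x \<in> ones (border_mat M k n) \<longleftrightarrow> (\<forall>i. x i \<in> {1..n}) \<and> card (middle M n x) \<le> k"
  by (auto simp: ones_def border_mat_def positions_def)

lemma border_mat_semisaturated:
  fixes \<P> :: "'d::finite mat01 set"
  assumes n: "2 * M \<le> n"
    and props: "\<And>F B. card F + k < CARD('d) \<Longrightarrow> \<exists>P\<in>\<P>. \<exists>e\<in>ones P.
      at_corner (dims P) F B e \<and> isolated P F k e \<and> (\<forall>i. dims P i \<le> M)"
  shows "semisaturated \<P> (border_mat M k n :: 'd mat01)"
  unfolding semisaturated_def
proof
  let ?A = "border_mat M k n :: 'd mat01"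
  fix x assume "x \<in> positions (dims ?A) - ones ?A"
  then have x: "\<And>i. 1 \<le> x i \<and> x i \<le> n" and mid: "k < card (middle M n x)"
    by (auto simp: ones_def border_mat_def positions_def)
  define F where "F = - middle M n x"
  \<comment> \<open>For a coordinate in \<open>F\<close>, this tells the low strip from the high
    one.\<close>
  define B where "B = {i. x i \<le> M}"
  have "card F + k < CARD('d)"
  proof -
    have "card (middle M n x) \<le> CARD('d)" by (rule card_mono) auto
    then show ?thesis using mid by (simp add: F_def card_Compl_finite)
  qed
  from props[OF this, of B] obtain P e where P: "P \<in> \<P>" and e: "e \<in> ones P"
    and corner: "at_corner (dims P) F B e" and iso: "isolated P F k e"
    and M: "\<And>i. dims P i \<le> M"
    by blast
  note eb = ones_bounds[OF e]
  \<comment> \<open>Index \<open>e i\<close> goes to \<open>x i\<close>, smaller indices stay at the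
    low end, and larger ones move to the last places of the high end.\<close>
  define \<phi> where "\<phi> i v = (if v < e i then v else if v = e i then x i else n - dims P i + v)" for i v
  define S where "S i = \<phi> i ` {1..dims P i}" for i
  \<comment> \<open>There must be room for \<open>e i - 1\<close> values below \<open>x i\<close>
    and \<open>dims P i - e i\<close> above it. In a strip the corner condition makes one of these
    numbers 0; in the middle each strip is wide enough.\<close>
  have low: "e i \<le> x i" and high: "x i \<le> n - (dims P i - e i)" for i
  proof -
    consider "i \<in> F" "i \<in> B" | "i \<in> F" "i \<notin> B" | "i \<notin> F" by blast
    then have "e i \<le> x i \<and> x i \<le> n - (dims P i - e i)"
    proof cases
      case 1
      then have "e i = 1" "x i \<le> M" using corner by (auto simp: at_corner_def B_def)
      then show ?thesis using x[of i] M[of i] n eb[of i] by auto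
    next
      case 2
      then have "e i = dims P i" "M < x i" using corner by (auto simp: at_corner_def B_def)
      then show ?thesis using x[of i] M[of i] n by auto
    next
      case 3
      then have "M < x i" "x i \<le> n - M" by (auto simp: F_def middle_def)
      then show ?thesis using M[of i] eb[of i] by linarith
    qed
    then show "e i \<le> x i" "x i \<le> n - (dims P i - e i)" by auto
  qed
  have mono: "strict_mono_on {1..dims P i} (\<phi> i)" for i
  proof (rule strict_mono_onI)
    fix v w assume "v \<in> {1..dims P i}" "w \<in> {1..dims P i}" "v < w"
    then show "\<phi> i v < \<phi> i w"
      using low[of i] high[of i] M[of i] n eb[of i] by (auto simp: \<phi>_def)
  qed
  have range: "\<phi> i v \<in> {1..n}" if "v \<in> {1..dims P i}" for i v
    using that x[of i] M[of i] n eb[of i] by (auto simp: \<phi>_def)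
  have origin: "origin S y = (\<lambda>i. \<phi> i (y i))" if "y \<in> ones P" for y
    unfolding origin_def S_def
    using enumerate_image_strict_mono[OF mono] ones_bounds[OF that] by blast
  have cardS: "card (S i) = dims P i" for i
    using strict_mono_on_imp_inj_on[OF mono[of i]] by (simp add: S_def card_image)
  have xe: "origin S e = x"
    by (simp add: origin[OF e] \<phi>_def)
  have "is_copy (set_one ?A x) S P"
    unfolding is_copy_def
  proof (intro conjI allI subsetI)
    show "v \<in> {1..dims (set_one ?A x) i}" if "v \<in> S i" for i v
      using that range by (auto simp: S_def border_mat_def)
    show "dims (submatrix (set_one ?A x) S) = dims P"
      by (simp add: submatrix_def cardS)
    fix y assume y: "y \<in> ones P"
    have "entry (set_one ?A x) (origin S y)"
    proof (cases "y = e")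
      case True
      then show ?thesis by (simp add: xe set_one_def)
    next
      case False
      \<comment> \<open>Indices other than \<open>e i\<close> are sent into the strips, so a middle
        coordinate of the image equals \<open>x i\<close>, and \<open>x i\<close> itself is then
        middle.\<close>
      have "middle M n (origin S y) \<subseteq> {i. i \<notin> F \<and> y i = e i}"
      proof
        fix i assume i: "i \<in> middle M n (origin S y)"
        have "y i = e i"
          using i ones_bounds[OF y, of i] M[of i] n eb[of i]
          by (auto simp: origin[OF y] middle_def \<phi>_def split: if_splits)
        then show "i \<in> {i. i \<notin> F \<and> y i = e i}"
          using i by (auto simp: origin[OF y] middle_def \<phi>_def F_def)
      qed
      then have "card (middle M n (origin S y)) \<le> card {i. i \<notin> F \<and> y i = e i}"
        by (intro card_mono) auto
      also have "\<dots> \<le> k" using iso y False by (auto simp: isolated_def)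
      finally show ?thesis by (simp add: set_one_def border_mat_def)
    qed
    then show "y \<in> ones (submatrix (set_one ?A x) S)"
      using ones_bounds[OF y] by (auto simp: ones_def positions_def submatrix_def cardS)
  qed
  then show "\<exists>P\<in>\<P>. \<exists>S. is_copy (set_one ?A x) S P \<and> x \<in> origin S ` ones P"
    using P e xe by blast
qed

text \<open>Sort the 1-entries by their set \<open>U\<close> of middle coordinates: there are at
  most \<open>2 ^ CARD('d)\<close> such sets, at most \<open>k\<close> coordinates have up to
  \<open>n\<close> values, and the others have at most \<open>2 * M\<close>.\<close>

lemma card_border_mat:
  assumes n: "1 \<le> n" and M: "1 \<le> M"
  shows "card (ones (border_mat M k n :: 'd::finite mat01)) \<le> (2 ^ CARD('d) * (2 * M) ^ CARD('d)) * n ^ k"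
proof -
  define T where "T U i = (if i \<in> U then {1..n} else {1..M} \<union> {n - M<..n})" for U and i :: 'd
  define X where "X U = {x. \<forall>i. x i \<in> T U i}" for U
  define I where "I = {U :: 'd set. card U \<le> k}"
  have "ones (border_mat M k n) \<subseteq> (\<Union>U\<in>I. X U)"
  proof
    fix x :: "'d \<Rightarrow> nat" assume "x \<in> ones (border_mat M k n)"
    then have "middle M n x \<in> I" "x \<in> X (middle M n x)"
      by (auto simp: ones_border_mat I_def X_def T_def middle_def)
    then show "x \<in> (\<Union>U\<in>I. X U)" by blast
  qed
  moreover have "finite (X U)" for U
    unfolding X_def by (rule finite_functions) (simp add: T_def)
  ultimately have "card (ones (border_mat M k n :: 'd mat01)) \<le> card (\<Union>U\<in>I. X U)"
    by (intro card_mono) auto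
  also have "\<dots> \<le> (\<Sum>U\<in>I. card (X U))"
    by (intro card_UN_le) simp
  also have "\<dots> \<le> (\<Sum>U\<in>I. (2 * M) ^ CARD('d) * n ^ k)"
  proof (rule sum_mono)
    fix U assume U: "U \<in> I"
    have T: "card (T U i) \<le> (if i \<in> U then n else 2 * M)" for i
    proof (cases "i \<in> U")
      case False
      have "card ({1..M} \<union> {n - M<..n}) \<le> card {1..M} + card {n - M<..n}" by (rule card_Un_le)
      then show ?thesis using False by (simp add: T_def)
    qed (simp add: T_def)
    have "card (X U) \<le> (\<Prod>i\<in>UNIV. if i \<in> U then n else 2 * M)"
      unfolding X_def card_functions by (rule prod_mono) (simp add: T)
    also have "\<dots> = n ^ card U * (2 * M) ^ card (- U)"
      by (subst prod.If_cases) auto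
    also have "\<dots> \<le> n ^ k * (2 * M) ^ CARD('d)"
      using U n M by (intro mult_mono power_increasing card_mono) (auto simp: I_def)
    finally show "card (X U) \<le> (2 * M) ^ CARD('d) * n ^ k" by (simp add: mult.commute)
  qed
  also have "\<dots> = card I * ((2 * M) ^ CARD('d) * n ^ k)" by simp
  also have "card I \<le> card (UNIV :: 'd set set)" by (rule card_mono) auto
  also have "card (UNIV :: 'd set set) = 2 ^ CARD('d)" by (simp add: card_UNIV_set)
  finally show ?thesis by (simp add: mult.assoc)
qed

text \<open>The family may be infinite with unbounded side lengths, but there are only finitely many
  pairs \<open>F\<close>, \<open>B\<close>, and one chosen matrix per pair suffices.\<close>

lemma corner_property_bounded:
  fixes \<P> :: "'d::finite mat01 set"
  assumes "\<And>F B. card F + k < CARD('d) \<Longrightarrow> corner_property \<P> k F B"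
  shows "\<exists>M\<ge>1. \<forall>F B. card F + k < CARD('d) \<longrightarrow> (\<exists>P\<in>\<P>. \<exists>e\<in>ones P.
      at_corner (dims P) F B e \<and> isolated P F k e \<and> (\<forall>i. dims P i \<le> M))"
proof -
  obtain P where P: "\<And>F B. card F + k < CARD('d) \<Longrightarrow>
      P F B \<in> \<P> \<and> (\<exists>e\<in>ones (P F B). at_corner (dims (P F B)) F B e \<and> isolated (P F B) F k e)"
    using assms unfolding corner_property_def by metis
  define M where "M = Max (insert 1 (range (\<lambda>(F, B, i). dims (P F B) i)))"
  have "dims (P F B) i \<le> M" for F B i
    unfolding M_def by (rule Max_ge) (auto intro: rev_image_eqI[of "(F, B, i)"])
  moreover have "1 \<le> M" unfolding M_def by (rule Max_ge) auto
  ultimately show ?thesis using P by (intro exI[of _ M]) blast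
qed

lemma ssat_upper:
  fixes \<P> :: "'d::finite mat01 set"
  assumes "\<And>F B. card F + k < CARD('d) \<Longrightarrow> corner_property \<P> k F B"
  shows "(\<lambda>n. real (ssat n \<P>)) \<in> O(\<lambda>n. real n ^ k)"
proof -
  obtain M where M: "1 \<le> M" and props: "\<And>F B. card F + k < CARD('d) \<Longrightarrow> \<exists>P\<in>\<P>. \<exists>e\<in>ones P.
      at_corner (dims P) F B e \<and> isolated P F k e \<and> (\<forall>i. dims P i \<le> M)"
    using corner_property_bounded[OF assms] by blast
  let ?c = "2 ^ CARD('d) * (2 * M) ^ CARD('d)"
  have "real (ssat n \<P>) \<le> real ?c * real n ^ k" if n: "2 * M \<le> n" for n
  proof -
    have "ssat n \<P> \<le> card (ones (border_mat M k n :: 'd mat01))"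
      using border_mat_semisaturated[OF n props] by (intro ssat_le) (simp_all add: border_mat_def)
    also have "\<dots> \<le> ?c * n ^ k"
      using n M by (intro card_border_mat) auto
    finally show ?thesis
      by (metis of_nat_le_iff of_nat_mult of_nat_power)
  qed
  then show ?thesis
    by (intro bigoI[of _ "real ?c"] eventually_at_top_linorderI[of "2 * M"]) auto
qed

theorem theorem4p3:
  fixes \<P> :: "'d::finite mat01 set"
  assumes "\<P> \<noteq> {}" and "\<forall>P\<in>\<P>. nonempty_mat P"
  shows "\<exists>k \<in> {0..CARD('d) - 1}.
           theta_power (\<lambda>n. ssat n \<P>) k \<and>
           property_i \<P> k \<and> property_ii \<P> k \<and>
           (\<forall>k' \<in> {0..CARD('d) - 1}. property_i \<P> k' \<and> property_ii \<P> k' \<longrightarrow> k \<le> k')"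
proof -
  define k where "k = (LEAST k. property_i \<P> k \<and> property_ii \<P> k)"
  note top = properties_top[OF assms]
  have k: "property_i \<P> k \<and> property_ii \<P> k"
    unfolding k_def by (rule LeastI) (rule top)
  have least: "k \<le> k'" if "property_i \<P> k' \<and> property_ii \<P> k'" for k'
    unfolding k_def using that by (rule Least_le)
  have kd: "k < CARD('d)"
    \<comment> \<open>\<open>LEAST\<close> ranges over all naturals; the admissible value
      \<open>CARD('d) - 1\<close> brings \<open>k\<close> into range.\<close>
    using least[OF top] zero_less_card_finite[where 'a='d] by linarith
  have upper: "(\<lambda>n. real (ssat n \<P>)) \<in> O(\<lambda>n. real n ^ k)"
    using k unfolding properties_iff[OF kd] by (intro ssat_upper) blast
  have "theta_power (\<lambda>n. ssat n \<P>) k"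
  proof (cases k)
    case 0
    then show ?thesis using upper by (simp add: theta_power_def)
  next
    case (Suc j)
    \<comment> \<open>Minimality of \<open>k\<close> makes the corner condition fail at
      \<open>k - 1\<close>, and the failing corner yields the lower bound of order
      \<open>n ^ k\<close>.\<close>
    have "\<not> (property_i \<P> j \<and> property_ii \<P> j)"
      using least[of j] Suc by auto
    then obtain F B where F: "card F + j < CARD('d)" "\<not> corner_property \<P> j F B"
      using Suc kd properties_iff[of j \<P>] by auto
    have "real n ^ k \<le> 2 ^ CARD('d) * real (ssat n \<P>)" if "1 \<le> n" for n
    proof -
      have "n ^ k \<le> 2 ^ CARD('d) * ssat n \<P>"
        using ssat_lower[OF F(2) _ that] F(1) Suc by simp
      then have "real (n ^ k) \<le> real (2 ^ CARD('d) * ssat n \<P>)"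
        by (rule of_nat_mono)
      then show ?thesis by simp
    qed
    then have "(\<lambda>n. real n ^ k) \<in> O(\<lambda>n. real (ssat n \<P>))"
      by (intro bigoI[of _ "2 ^ CARD('d)"] eventually_at_top_linorderI[of 1]) auto
    then show ?thesis
      using upper Suc by (simp add: theta_power_def bigtheta_def bigomega_iff_bigo)
  qed
  then show ?thesis
    using k least kd by (intro bexI[of _ k]) auto
qed

end
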